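(* For any sequence $(K_n)_{n\in\omega}$ of nonmetrizable Eberlein compact spaces, the product $\prod_{n\in\omega}K_n$ is not NY compact.
   Context: All topological spaces are assumed to be completely regular Hausdorff (Tikhonov). A compact space is Eberlein compact if it is homeomorphic to a weakly compact subset of a Banach space. Given nonempty spaces $X_\gamma$ ($\gamma\in\Gamma$) and fixed points $a_\gamma\in X_\gamma$, the $\sigma$-product is $\sigma(X_\gamma,a_\gamma,\Gamma)=\{(x_\gamma)_{\gamma\in\Gamma}\in\prod_{\gamma\in\Gamma}X_\gamma:\ |\{\gamma\in\Gamma: x_\gamma\neq a_\gamma\}|<\omega\}$ with the topology inherited from the product. A compact space $K$ is NY compact if it can be embedded (homeomorphically) into some $\sigma$-product of metrizable compact spaces. *)

theory Defs
  imports "HOL-Analysis.Analysis"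
begin

text \<open>
  HOL cannot quantify over types inside a formula, so the Banach spaces and the families of
  metrizable compacta occurring in the definitions below are given on explicit carriers inside
  ambient types. These ambient types are parameters (\<open>itself\<close> arguments) of the definitions.

  A real Banach space is a linear subspace \<open>V\<close> of an ambient real vector space, which carries no
  norm of its own, with a complete norm \<open>N\<close> on \<open>V\<close>. Different spaces on the same ambient type may
  thus have unrelated norms, and any family of Banach spaces can be realised on one ambient type,
  for example their algebraic direct sum.
\<close>

text \<open>
  Completeness is written out because the locale \<open>Metric_space\<close> constrains the distance on the
  whole ambient type, whereas \<open>N\<close> is arbitrary outside \<open>V\<close>.
\<close>

definition banach_space_on :: "'v::real_vector set \<Rightarrow> ('v \<Rightarrow> real) \<Rightarrow> bool" where
  "banach_space_on V N \<longleftrightarrow>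
     subspace V \<and>
     (\<forall>x\<in>V. 0 \<le> N x) \<and>
     (\<forall>x\<in>V. N x = 0 \<longleftrightarrow> x = 0) \<and>
     (\<forall>c. \<forall>x\<in>V. N (c *\<^sub>R x) = \<bar>c\<bar> * N x) \<and>
     (\<forall>x\<in>V. \<forall>y\<in>V. N (x + y) \<le> N x + N y) \<and>
     (\<forall>s :: nat \<Rightarrow> 'v. range s \<subseteq> V \<and> (\<forall>e>0. \<exists>M. \<forall>m\<ge>M. \<forall>n\<ge>M. N (s m - s n) < e) \<longrightarrow>
        (\<exists>l\<in>V. (\<lambda>n. N (s n - l)) \<longlonglongrightarrow> 0))"

definition bounded_functional_on :: "'v::real_vector set \<Rightarrow> ('v \<Rightarrow> real) \<Rightarrow> ('v \<Rightarrow> real) \<Rightarrow> bool" where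
  "bounded_functional_on V N f \<longleftrightarrow>
     (\<forall>x\<in>V. \<forall>y\<in>V. f (x + y) = f x + f y) \<and>
     (\<forall>c. \<forall>x\<in>V. f (c *\<^sub>R x) = c * f x) \<and>
     (\<exists>C. \<forall>x\<in>V. \<bar>f x\<bar> \<le> C * N x)"

definition weak_topology :: "'v::real_vector set \<Rightarrow> ('v \<Rightarrow> real) \<Rightarrow> 'v topology" where
  "weak_topology V N =
     topology_generated_by {{x \<in> V. f x \<in> U} | f U. bounded_functional_on V N f \<and> open U}"

lemma topspace_weak_topology [simp]: "topspace (weak_topology V N) = V"
proof -
  have "bounded_functional_on V N (\<lambda>_. 0)"
    by (auto simp: bounded_functional_on_def intro: exI[of _ 0])
  then have "V \<in> {{x \<in> V. f x \<in> U} | f U. bounded_functional_on V N f \<and> open U}"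
    by (intro CollectI exI[of _ "\<lambda>_. 0"] exI[of _ UNIV]) auto
  then show ?thesis
    unfolding weak_topology_def topology_generated_by_topspace by blast
qed

text \<open>
  All spaces are understood to be Tikhonov, so ``compact space'' means compact Hausdorff space.
\<close>

definition Eberlein_compact :: "'v::real_vector itself \<Rightarrow> 'a topology \<Rightarrow> bool" where
  "Eberlein_compact _ K \<longleftrightarrow>
     compact_space K \<and> Hausdorff_space K \<and>
     (\<exists>(V :: 'v set) N S. banach_space_on V N \<and> compactin (weak_topology V N) S \<and>
        K homeomorphic_space subtopology (weak_topology V N) S)"

definition sigma_product :: "('i \<Rightarrow> 'x topology) \<Rightarrow> ('i \<Rightarrow> 'x) \<Rightarrow> 'i set \<Rightarrow> ('i \<Rightarrow> 'x) topology" where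
  "sigma_product X a \<Gamma> =
     subtopology (product_topology X \<Gamma>)
       {x \<in> topspace (product_topology X \<Gamma>). finite {\<gamma> \<in> \<Gamma>. x \<gamma> \<noteq> a \<gamma>}}"

definition NY_compact :: "'i itself \<Rightarrow> 'x itself \<Rightarrow> 'a topology \<Rightarrow> bool" where
  "NY_compact _ _ K \<longleftrightarrow>
     compact_space K \<and> Hausdorff_space K \<and>
     (\<exists>(\<Gamma> :: 'i set) (X :: 'i \<Rightarrow> 'x topology) a.
        (\<forall>\<gamma>\<in>\<Gamma>. compact_space (X \<gamma>) \<and> metrizable_space (X \<gamma>) \<and> a \<gamma> \<in> topspace (X \<gamma>)) \<and>
        (\<exists>f. embedding_map K (sigma_product X a \<Gamma>) f))"

end

theory Submission
  imports Defs
begin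

text \<open>
  By the Baire category theorem, some open box of the product is mapped to points with supports of
  size at most \<open>m\<close>. The contradiction is that among any \<open>m + 1\<close> factors of a box whose points have
  at most \<open>m\<close> support elements outside a finite set \<open>F\<close>, one is metrizable. This goes by induction
  on \<open>m\<close>: freeze all of these factors but one, \<open>j\<close>, at points without metrizable neighbourhoods. If
  all points obtained by varying the coordinate \<open>j\<close> had support in \<open>F\<close>, the factor \<open>j\<close> would embed
  into a finite product of metrizable spaces. So some point has a support element \<open>\<gamma>\<close> outside \<open>F\<close>,
  which persists on a smaller box, and moving \<open>\<gamma>\<close> into \<open>F\<close> decreases \<open>m\<close>.
\<close>

section \<open>Countable separation: relation to metrizability, and from local to global\<close>

text \<open>
  For compact spaces this is equivalent to metrizability, but it passes more easily from local to
  global and to spaces embedded in finite products.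
\<close>

definition countably_separated :: "'a topology \<Rightarrow> bool" where
  "countably_separated Y \<longleftrightarrow>
     (\<exists>\<Phi> :: ('a \<Rightarrow> real) set. countable \<Phi> \<and> (\<forall>g\<in>\<Phi>. continuous_map Y euclideanreal g) \<and>
        (\<forall>x\<in>topspace Y. \<forall>y\<in>topspace Y. (\<forall>g\<in>\<Phi>. g x = g y) \<longrightarrow> x = y))"

text \<open>An enumeration of the separating functions is a continuous injection of \<open>Y\<close>
  into the metrizable space of real sequences. A continuous map from a compact to a Hausdorff space
  is closed, so this injection is an embedding.\<close>

lemma compact_countably_separated_imp_metrizable:
  assumes "compact_space Y" "countably_separated Y"
  shows "metrizable_space Y"
proof -
  obtain \<Phi> :: "('a \<Rightarrow> real) set" where \<Phi>: "countable \<Phi>"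
      "\<And>g. g \<in> \<Phi> \<Longrightarrow> continuous_map Y euclideanreal g"
    and sep: "\<And>x y. \<lbrakk>x \<in> topspace Y; y \<in> topspace Y; \<forall>g\<in>\<Phi>. g x = g y\<rbrakk> \<Longrightarrow> x = y"
    using assms(2) unfolding countably_separated_def by metis
  \<comment> \<open>The zero function makes the family nonempty, so that
    \<open>from_nat_into\<close> enumerates exactly \<open>\<Psi>\<close>.\<close>
  define \<Psi> where "\<Psi> = insert (\<lambda>_. 0) \<Phi>"
  define e where "e x n = from_nat_into \<Psi> n x" for x :: 'a and n
  have rng: "range (from_nat_into \<Psi>) = \<Psi>"
    using \<Phi>(1) by (intro range_from_nat_into) (auto simp: \<Psi>_def)
  have cont: "continuous_map Y (euclidean :: (nat \<Rightarrow> real) topology) e"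
    unfolding euclidean_product_topology[symmetric] continuous_map_componentwise_UNIV
  proof
    fix n
    have "from_nat_into \<Psi> n \<in> \<Psi>" using rng by blast
    then show "continuous_map Y euclidean (\<lambda>x. e x n)"
      using \<Phi>(2) by (auto simp: e_def \<Psi>_def)
  qed
  have "inj_on e (topspace Y)"
  proof (rule inj_onI)
    fix x y assume xy: "x \<in> topspace Y" "y \<in> topspace Y" "e x = e y"
    have "g x = g y" if "g \<in> \<Phi>" for g
    proof -
      have "g \<in> range (from_nat_into \<Psi>)" using rng that by (simp add: \<Psi>_def)
      then obtain n where "g = from_nat_into \<Psi> n" by blast
      then show ?thesis using fun_cong[OF xy(3), of n] by (simp add: e_def)
    qed
    then show "x = y" using sep xy by blast
  qed
  moreover have "closed_map Y euclidean e"
    using cont assms(1) by (simp add: continuous_imp_closed_map_gen Hausdorff_imp_kc_space)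
  ultimately have "embedding_map Y euclidean e"
    using cont injective_closed_imp_embedding_map by blast
  then show ?thesis
    using embedding_map_imp_homeomorphic_space homeomorphic_metrizable_space
      metrizable_space_subtopology metrizable_space_euclidean by blast
qed

text \<open>Total boundedness gives finite \<open>1/(n+1)\<close>-nets. The distances to the points
  of their countable dense union \<open>E\<close> separate points.\<close>

lemma compact_metrizable_imp_countably_separated:
  assumes "compact_space Z" "metrizable_space Z"
  shows "countably_separated Z"
proof -
  obtain M d where "Metric_space M d" and Z: "Z = Metric_space.mtopology M d"
    using assms(2) by (auto simp: metrizable_space_def)
  then interpret Metric_space M d by simp
  have "mtotally_bounded M"
    using assms(1) Z compact_space_eq_mcomplete_mtotally_bounded by blast
  then have "\<exists>D. finite D \<and> D \<subseteq> M \<and> M \<subseteq> (\<Union>x\<in>D. mball x (1 / real (Suc n)))" for n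
    unfolding mtotally_bounded_def by simp
  then obtain D where D: "\<And>n. finite (D n)" "\<And>n. D n \<subseteq> M"
      "\<And>n. M \<subseteq> (\<Union>x\<in>D n. mball x (1 / real (Suc n)))"
    by metis
  define E where "E = (\<Union>n. D n)"
  have "countable E" using D(1) by (auto simp: E_def intro: countable_finite)
  moreover have "continuous_map Z euclideanreal (d z)" if "z \<in> E" for z
  proof -
    have "z \<in> M" using that D(2) by (auto simp: E_def)
    show ?thesis
      using continuous_on_mdist[of z Self] \<open>z \<in> M\<close>
      by (simp add: Z mtopology_of_def)
  qed
  moreover have "x = y" if xy: "x \<in> M" "y \<in> M" "\<forall>z\<in>E. d z x = d z y" for x y
  proof (rule ccontr)
    assume "x \<noteq> y"
    \<comment> \<open>A net point \<open>z\<close> closer to \<open>x\<close> than half of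
      \<open>d x y\<close> is equally close to \<open>y\<close>, which violates the triangle
      inequality.\<close>
    then have "0 < d x y / 2" using xy by simp
    then obtain n where n: "1 / real (Suc n) < d x y / 2" by (rule nat_approx_posE)
    obtain z where z: "z \<in> D n" "z \<in> M" "d z x < 1 / real (Suc n)"
      using subsetD[OF D(3)[of n] xy(1)] by auto
    then have "d z y = d z x" using xy(3) unfolding E_def by auto
    then show False
      using xy n z triangle[of x z y] commute[of x z] by linarith
  qed
  ultimately show ?thesis
    unfolding countably_separated_def
    by (intro exI[of _ "d ` E"]) (auto simp: Z)
qed

text \<open>Functions separating points of \<open>C\<close> extend to \<open>Y\<close> by Tietze.
  The extensions say nothing about points outside \<open>C\<close>, so one Urysohn function is added
  to tell points near \<open>x\<close> from those outside \<open>U\<close>. By compactness finitely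
  many such countable families suffice.\<close>

lemma locally_countably_separated_imp_countably_separated:
  assumes "compact_space Y" "Hausdorff_space Y"
    and loc: "\<And>x. x \<in> topspace Y \<Longrightarrow>
      \<exists>U C. openin Y U \<and> closedin Y C \<and> x \<in> U \<and> U \<subseteq> C \<and> countably_separated (subtopology Y C)"
  shows "countably_separated Y"
proof -
  have normal: "normal_space Y" and regular: "regular_space Y"
    using assms by (auto simp: compact_Hausdorff_or_regular_imp_normal_space
        compact_Hausdorff_imp_regular_space)
  \<comment> \<open>The condition is asymmetric: \<open>y\<close> is confined to \<open>W\<close>,
    but \<open>z\<close> ranges over the whole space. Hence the families of a cover by such sets
    \<open>W\<close> together separate all points.\<close>
  define separates where "separates W \<Phi> \<longleftrightarrow> openin Y W \<and> countable \<Phi> \<and>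
      (\<forall>g\<in>\<Phi>. continuous_map Y euclideanreal g) \<and>
      (\<forall>y\<in>W. \<forall>z\<in>topspace Y. (\<forall>g\<in>\<Phi>. g y = g z) \<longrightarrow> y = z)" for W \<Phi>
  have "\<exists>W \<Phi>. x \<in> W \<and> separates W \<Phi>"
    if x: "x \<in> topspace Y" for x
  proof -
    obtain U C where UC: "openin Y U" "closedin Y C" "x \<in> U" "U \<subseteq> C"
        "countably_separated (subtopology Y C)"
      using loc[OF x] by blast
    obtain \<Phi> :: "('a \<Rightarrow> real) set" where \<Phi>: "countable \<Phi>"
        "\<And>g. g \<in> \<Phi> \<Longrightarrow> continuous_map (subtopology Y C) euclideanreal g"
      and sep: "\<And>y z. \<lbrakk>y \<in> C; z \<in> C; \<forall>g\<in>\<Phi>. g y = g z\<rbrakk> \<Longrightarrow> y = z"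
      using UC(5) closedin_subset[OF UC(2)] unfolding countably_separated_def
      by (auto simp: inf_absorb2 subset_iff)
    have "\<exists>h. continuous_map Y euclideanreal h \<and> (\<forall>y\<in>C. h y = g y)" if "g \<in> \<Phi>" for g
      using Tietze_extension_realinterval[OF normal UC(2) is_interval_univ _ \<Phi>(2)[OF that]]
      by (metis UNIV_not_empty subset_UNIV)
    then obtain T where T: "\<And>g. g \<in> \<Phi> \<Longrightarrow> continuous_map Y euclideanreal (T g)"
        "\<And>g y. \<lbrakk>g \<in> \<Phi>; y \<in> C\<rbrakk> \<Longrightarrow> T g y = g y"
      by metis
    \<comment> \<open>The Urysohn lemma needs disjoint closed sets, hence a closed neighbourhood
      \<open>D\<close> of \<open>x\<close> inside \<open>U\<close>.\<close>
    obtain W D where WD: "openin Y W" "closedin Y D" "x \<in> W" "W \<subseteq> D" "D \<subseteq> U"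
      using regular UC unfolding neighbourhood_base_of_closedin[symmetric] neighbourhood_base_of
      by metis
    have "closedin Y (topspace Y - U)" "disjnt D (topspace Y - U)"
      using UC WD by (auto simp: disjnt_iff)
    then obtain u where u: "continuous_map Y (top_of_set {0..1::real}) u"
        "u ` D \<subseteq> {0}" "u ` (topspace Y - U) \<subseteq> {1}"
      using Urysohn_lemma[OF normal WD(2), of "topspace Y - U" 0 1] by auto
    show ?thesis
      unfolding separates_def
    proof (intro exI conjI ballI impI)
      show "countable (insert u (T ` \<Phi>))" using \<Phi>(1) by simp
      show "continuous_map Y euclideanreal g" if "g \<in> insert u (T ` \<Phi>)" for g
        using that u(1) T(1) continuous_map_into_fulltopology by blast
      fix y z assume yz: "y \<in> W" "z \<in> topspace Y" "\<forall>g\<in>insert u (T ` \<Phi>). g y = g z"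
      have "u y = 0" using yz(1) u(2) WD(4) by auto
      \<comment> \<open>Since \<open>u z = u y = 0\<close>, the point \<open>z\<close> cannot lie
        outside \<open>U\<close>, where \<open>u\<close> is 1.\<close>
      then have "z \<in> C" using yz u(3) UC(4) by force
      moreover have "y \<in> C" using yz(1) WD UC by blast
      ultimately show "y = z" using sep yz(3) T(2) by (metis image_eqI insertCI)
    qed (use WD in auto)
  qed
  then obtain W \<Phi> where W: "\<And>x. x \<in> topspace Y \<Longrightarrow> x \<in> W x"
    and \<Phi>: "\<And>x. x \<in> topspace Y \<Longrightarrow> separates (W x) (\<Phi> x)"
    by metis
  obtain A where A: "finite A" "A \<subseteq> topspace Y" "topspace Y \<subseteq> (\<Union>x\<in>A. W x)"
  proof -
    have "\<exists>\<F>. finite \<F> \<and> \<F> \<subseteq> W ` topspace Y \<and> topspace Y \<subseteq> \<Union>\<F>"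
    proof (rule compactinD)
      show "compactin Y (topspace Y)" using assms(1) by (simp add: compact_space_def)
      show "openin Y U" if "U \<in> W ` topspace Y" for U
        using that \<Phi> unfolding separates_def by blast
    qed (use W in blast)
    then show ?thesis using that by (metis finite_subset_image)
  qed
  show ?thesis
    unfolding countably_separated_def
  proof (intro exI[of _ "\<Union>x\<in>A. \<Phi> x"] conjI ballI impI)
    show "countable (\<Union>x\<in>A. \<Phi> x)"
      using A \<Phi> unfolding separates_def by (intro countable_UN) (auto intro: countable_finite)
    show "continuous_map Y euclideanreal g" if "g \<in> (\<Union>x\<in>A. \<Phi> x)" for g
      using that A \<Phi> unfolding separates_def by blast
    fix y z assume "y \<in> topspace Y" "z \<in> topspace Y" "\<forall>g\<in>\<Union>x\<in>A. \<Phi> x. g y = g z"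
    moreover then obtain x where "x \<in> A" "y \<in> W x" using A by blast
    ultimately show "y = z" using A(2) \<Phi>[of x] unfolding separates_def by blast
  qed
qed

section \<open>Closed boxes whose points have bounded supports\<close>

lemma product_topology_open_box:
  assumes "openin (product_topology K UNIV) U" "x \<in> U"
  obtains W where "\<And>n. openin (K n) (W n)" "\<And>n. x n \<in> W n"
    "finite {n. W n \<noteq> topspace (K n)}" "\<And>y. (\<And>n. y n \<in> W n) \<Longrightarrow> y \<in> U"
proof -
  obtain W where "x \<in> Pi\<^sub>E UNIV W" "\<forall>n. openin (K n) (W n)"
      "finite {n. W n \<noteq> topspace (K n)}" "Pi\<^sub>E UNIV W \<subseteq> U"
    using product_topology_open_contains_basis[OF assms] by blast
  then show ?thesis
    by (intro that[of W]) (auto simp: PiE_iff)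
qed

text \<open>Induction on \<open>m\<close> with \<open>F\<close>, \<open>B\<close> and
  \<open>J\<close> varying: the step adds a support element to \<open>F\<close>, shrinks the closed
  box \<open>B\<close> and drops one index from \<open>J\<close>. There is one index more than the
  bound \<open>m\<close>, so that for \<open>m = 0\<close> an index is left to vary.\<close>

lemma bounded_support_imp_countably_separated_factor:
  fixes K :: "'n \<Rightarrow> 'a topology" and f :: "('n \<Rightarrow> 'a) \<Rightarrow> 'i \<Rightarrow> 'x"
  assumes K: "\<And>n. compact_space (K n)" "\<And>n. Hausdorff_space (K n)"
    and X: "\<And>\<gamma>. \<gamma> \<in> \<Gamma> \<Longrightarrow> countably_separated (X \<gamma>)" "\<And>\<gamma>. \<gamma> \<in> \<Gamma> \<Longrightarrow> t1_space (X \<gamma>)"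
    and cont: "\<And>\<gamma>. \<gamma> \<in> \<Gamma> \<Longrightarrow> continuous_map (product_topology K UNIV) (X \<gamma>) (\<lambda>x. f x \<gamma>)"
    and inj: "\<And>x y. \<lbrakk>\<And>n. x n \<in> topspace (K n); \<And>n. y n \<in> topspace (K n);
                \<And>\<gamma>. \<gamma> \<in> \<Gamma> \<Longrightarrow> f x \<gamma> = f y \<gamma>\<rbrakk> \<Longrightarrow> x = y"
    and fin: "\<And>x. (\<And>n. x n \<in> topspace (K n)) \<Longrightarrow> finite {\<gamma>\<in>\<Gamma>. f x \<gamma> \<noteq> a \<gamma>}"
    and "finite F" "F \<subseteq> \<Gamma>" "\<And>n. closedin (K n) (B n)" "\<And>n. B n \<noteq> {}"
    and "\<And>x. (\<And>n. x n \<in> B n) \<Longrightarrow> card ({\<gamma>\<in>\<Gamma>. f x \<gamma> \<noteq> a \<gamma>} - F) \<le> m"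
    and "card J = Suc m"
  shows "\<exists>j\<in>J. countably_separated (subtopology (K j) (B j))"
  using assms(8-)
proof (induction m arbitrary: F B J)
  \<comment> \<open>Common to both cases: on the line through \<open>b\<close> in direction
    \<open>j\<close>, all coordinates of \<open>f\<close> outside \<open>F\<close> are constantly
    \<open>a \<gamma>\<close>. Since \<open>f\<close> is injective, the coordinates in
    \<open>F\<close> alone separate points, and the functions separating points of these
    \<open>X \<gamma>\<close> can be pulled back.\<close>
  have separated: "countably_separated (subtopology (K j) (B j))"
    if F: "finite F" "F \<subseteq> \<Gamma>" and b: "\<And>n. b n \<in> topspace (K n)" and B: "B j \<subseteq> topspace (K j)"
      and supp: "\<And>t. t \<in> B j \<Longrightarrow> {\<gamma>\<in>\<Gamma>. f (b(j := t)) \<gamma> \<noteq> a \<gamma>} \<subseteq> F" for F B b j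
  proof -
    define sep where "sep \<gamma> \<Phi> \<longleftrightarrow> countable \<Phi> \<and>
        (\<forall>g\<in>\<Phi>. continuous_map (X \<gamma>) euclideanreal g) \<and>
        (\<forall>x\<in>topspace (X \<gamma>). \<forall>y\<in>topspace (X \<gamma>). (\<forall>g\<in>\<Phi>. g x = g y) \<longrightarrow> x = y)" for \<gamma> \<Phi>
    have "\<And>\<gamma>. \<gamma> \<in> \<Gamma> \<Longrightarrow> \<exists>\<Phi>. sep \<gamma> \<Phi>"
      using X(1) unfolding countably_separated_def sep_def by blast
    then obtain \<Phi> where "\<And>\<gamma>. \<gamma> \<in> \<Gamma> \<Longrightarrow> sep \<gamma> (\<Phi> \<gamma>)"
      by metis
    then have \<Phi>: "\<And>\<gamma>. \<gamma> \<in> \<Gamma> \<Longrightarrow> countable (\<Phi> \<gamma>)"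
      "\<And>\<gamma> g. \<lbrakk>\<gamma> \<in> \<Gamma>; g \<in> \<Phi> \<gamma>\<rbrakk> \<Longrightarrow> continuous_map (X \<gamma>) euclideanreal g"
      "\<And>\<gamma> x y. \<lbrakk>\<gamma> \<in> \<Gamma>; x \<in> topspace (X \<gamma>); y \<in> topspace (X \<gamma>); \<forall>g\<in>\<Phi> \<gamma>. g x = g y\<rbrakk> \<Longrightarrow> x = y"
      unfolding sep_def by blast+
    have cb: "continuous_map (subtopology (K j) (B j)) (product_topology K UNIV) (\<lambda>t. b(j := t))"
      unfolding continuous_map_componentwise_UNIV
    proof
      fix n show "continuous_map (subtopology (K j) (B j)) (K n) (\<lambda>t. (b(j := t)) n)"
        using b by (cases "n = j") (auto simp: continuous_map_from_subtopology)
    qed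
    have cf: "continuous_map (subtopology (K j) (B j)) (X \<gamma>) (\<lambda>t. f (b(j := t)) \<gamma>)"
      if "\<gamma> \<in> \<Gamma>" for \<gamma>
      using continuous_map_compose[OF cb cont[OF that]] by (simp add: o_def)
    define \<Psi> where "\<Psi> = (\<Union>\<gamma>\<in>F. (\<lambda>g t. g (f (b(j := t)) \<gamma>)) ` \<Phi> \<gamma>)"
    show ?thesis
      unfolding countably_separated_def
    proof (intro exI[of _ \<Psi>] conjI ballI impI)
      show "countable \<Psi>"
        using F \<Phi>(1) unfolding \<Psi>_def
        by (intro countable_UN countable_image) (auto intro: countable_finite)
      show "continuous_map (subtopology (K j) (B j)) euclideanreal h" if "h \<in> \<Psi>" for h
      proof -
        obtain \<gamma> g where "\<gamma> \<in> F" "g \<in> \<Phi> \<gamma>" and h: "h = (\<lambda>t. g (f (b(j := t)) \<gamma>))"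
          using \<open>h \<in> \<Psi>\<close> unfolding \<Psi>_def by blast
        then have "\<gamma> \<in> \<Gamma>" using F by blast
        then show ?thesis
          using continuous_map_compose[OF cf \<Phi>(2)[OF _ \<open>g \<in> \<Phi> \<gamma>\<close>]] by (simp add: o_def h)
      qed
      fix s t assume "s \<in> topspace (subtopology (K j) (B j))"
        "t \<in> topspace (subtopology (K j) (B j))" and eq: "\<forall>h\<in>\<Psi>. h s = h t"
      then have st: "s \<in> B j" "t \<in> B j" "s \<in> topspace (K j)" "t \<in> topspace (K j)" by auto
      have "f (b(j := s)) \<gamma> = f (b(j := t)) \<gamma>" if "\<gamma> \<in> \<Gamma>" for \<gamma>
      proof (cases "\<gamma> \<in> F")
        case True
        have fX: "f (b(j := r)) \<gamma> \<in> topspace (X \<gamma>)" if "r \<in> B j" "r \<in> topspace (K j)" for r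
          using continuous_map_image_subset_topspace[OF cf[OF \<open>\<gamma> \<in> \<Gamma>\<close>]] that by auto
        have "g (f (b(j := s)) \<gamma>) = g (f (b(j := t)) \<gamma>)" if "g \<in> \<Phi> \<gamma>" for g
        proof -
          have "(\<lambda>t. g (f (b(j := t)) \<gamma>)) \<in> \<Psi>"
            using True that unfolding \<Psi>_def by blast
          from bspec[OF eq this] show ?thesis by simp
        qed
        then show ?thesis
          using \<Phi>(3)[OF \<open>\<gamma> \<in> \<Gamma>\<close> fX fX] st by blast
      next
        case False
        have "f (b(j := r)) \<gamma> = a \<gamma>" if "r \<in> B j" for r
          using supp[OF that] False \<open>\<gamma> \<in> \<Gamma>\<close> by blast
        then show ?thesis using st by simp
      qed
      then have "b(j := s) = b(j := t)"
        by (rule inj[rotated 2]) (use b st in auto)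
      then show "s = t" by (metis fun_upd_same)
    qed
  qed
  {
    case 0
    then obtain j where J: "J = {j}" by (metis One_nat_def card_1_singletonE)
    have "\<exists>x. x \<in> B n" for n using 0(4) by blast
    then obtain b where b: "\<And>n. b n \<in> B n" by metis
    have B: "B n \<subseteq> topspace (K n)" for n using 0(3) closedin_subset by blast
    have "countably_separated (subtopology (K j) (B j))"
    proof (rule separated[OF 0(1,2), of b])
      fix t assume "t \<in> B j"
      then have mem: "(b(j := t)) n \<in> B n" for n using b by simp
      \<comment> \<open>Finiteness must be checked because \<open>card\<close> of an infinite set is
        0; only with it does the bound 0 force the support into \<open>F\<close>.\<close>
      have "finite {\<gamma>\<in>\<Gamma>. f (b(j := t)) \<gamma> \<noteq> a \<gamma>}"
        using mem B by (intro fin) blast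
      moreover have "card ({\<gamma>\<in>\<Gamma>. f (b(j := t)) \<gamma> \<noteq> a \<gamma>} - F) \<le> 0"
        by (rule 0(5)) (rule mem)
      ultimately show "{\<gamma>\<in>\<Gamma>. f (b(j := t)) \<gamma> \<noteq> a \<gamma>} \<subseteq> F"
        by simp
    qed (use b B in blast)+
    then show ?case using J by blast
  next
    case (Suc m)
    have B: "B n \<subseteq> topspace (K n)" for n using Suc.prems(3) closedin_subset by blast
    show ?case
    proof (rule ccontr)
      assume neg: "\<not> ?thesis"
      obtain j where j: "j \<in> J" using Suc.prems(6) by fastforce
      define J' where "J' = J - {j}"
      have J': "card J' = Suc m" using Suc.prems(6) j by (simp add: J'_def)
      \<comment> \<open>The local-to-global lemma in contrapositive form: \<open>B i\<close> is not
        countably separated, so it fails to be so near some point \<open>p\<close>.\<close>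
      have "\<exists>p\<in>B i. \<forall>U C. openin (subtopology (K i) (B i)) U \<longrightarrow> closedin (subtopology (K i) (B i)) C
          \<longrightarrow> p \<in> U \<longrightarrow> U \<subseteq> C \<longrightarrow> \<not> countably_separated (subtopology (subtopology (K i) (B i)) C)"
        if "i \<in> J'" for i
      proof -
        have "\<not> countably_separated (subtopology (K i) (B i))" using neg that J'_def by blast
        moreover have "compact_space (subtopology (K i) (B i))"
          using K(1) Suc.prems(3) closedin_compact_space compact_space_subtopology by blast
        ultimately show ?thesis
          using locally_countably_separated_imp_countably_separated[of "subtopology (K i) (B i)"]
            Hausdorff_space_subtopology[OF K(2)] by (metis Int_iff topspace_subtopology)
      qed
      then obtain p where p: "\<And>i. i \<in> J' \<Longrightarrow> p i \<in> B i"
        and nonsep: "\<And>i U C. \<lbrakk>i \<in> J'; openin (subtopology (K i) (B i)) U;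
            closedin (subtopology (K i) (B i)) C; p i \<in> U; U \<subseteq> C\<rbrakk>
          \<Longrightarrow> \<not> countably_separated (subtopology (subtopology (K i) (B i)) C)"
        by metis
      have "\<exists>x. x \<in> B n" for n using Suc.prems(4) by blast
      then obtain c where c: "\<And>n. c n \<in> B n" by metis
      \<comment> \<open>The coordinates in \<open>J'\<close> are frozen at the bad points, the
        others arbitrarily; \<open>j\<close> is not in \<open>J'\<close> and stays free to
        vary.\<close>
      define b where "b n = (if n \<in> J' then p n else c n)" for n
      have b: "b n \<in> B n" for n using p c by (simp add: b_def)
      have "\<not> countably_separated (subtopology (K j) (B j))" using neg j by blast
      then obtain t where t: "t \<in> B j" "\<not> {\<gamma>\<in>\<Gamma>. f (b(j := t)) \<gamma> \<noteq> a \<gamma>} \<subseteq> F"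
        using separated[OF Suc.prems(1,2), of b B j] b B by blast
      define y where "y = b(j := t)"
      have y: "y n \<in> B n" for n using b t by (simp add: y_def)
      obtain \<gamma> where \<gamma>: "\<gamma> \<in> \<Gamma>" "\<gamma> \<notin> F" "f y \<gamma> \<noteq> a \<gamma>" using t(2) y_def by blast
      have yP: "y \<in> topspace (product_topology K UNIV)" using y B by (auto simp: PiE_UNIV_domain)
      \<comment> \<open>Points of \<open>X \<gamma>\<close> are closed, so \<open>\<gamma>\<close>
        remains in the support on an open set around \<open>y\<close>.\<close>
      define V where "V = {x \<in> topspace (product_topology K UNIV). f x \<gamma> \<in> topspace (X \<gamma>) - {a \<gamma>}}"
      have "openin (X \<gamma>) (topspace (X \<gamma>) - {a \<gamma>})"
        using X(2)[OF \<gamma>(1)] by (simp add: t1_space_openin_delete_alt)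
      then have "openin (product_topology K UNIV) V"
        unfolding V_def using openin_continuous_map_preimage[OF cont[OF \<gamma>(1)]] by blast
      moreover have "y \<in> V"
        using yP \<gamma> continuous_map_image_subset_topspace[OF cont[OF \<gamma>(1)]] by (auto simp: V_def)
      ultimately obtain W where W: "\<And>n. openin (K n) (W n)" "\<And>n. y n \<in> W n"
          "\<And>x. (\<And>n. x n \<in> W n) \<Longrightarrow> x \<in> V"
        by (rule product_topology_open_box) blast
      \<comment> \<open>By regularity the box shrinks to closed sets \<open>C n\<close> on which
        \<open>\<gamma>\<close> stays in the support. Each is still a neighbourhood of
        \<open>y n\<close> relative to \<open>B n\<close>, as the choice of \<open>p\<close>
        requires.\<close>
      have "\<exists>U C. openin (subtopology (K n) (B n)) U \<and> closedin (subtopology (K n) (B n)) C \<and>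
          y n \<in> U \<and> U \<subseteq> C \<and> C \<subseteq> B n \<inter> W n" for n
      proof -
        have "regular_space (subtopology (K n) (B n))"
          using K compact_Hausdorff_imp_regular_space regular_space_subtopology by blast
        moreover have "openin (subtopology (K n) (B n)) (B n \<inter> W n)"
          using W(1) by (metis openin_subtopology_Int2)
        ultimately show ?thesis
          using W(2) y unfolding neighbourhood_base_of_closedin[symmetric] neighbourhood_base_of
          by (metis IntI)
      qed
      then obtain U C where U: "\<And>n. openin (subtopology (K n) (B n)) (U n)"
          "\<And>n. y n \<in> U n" "\<And>n. U n \<subseteq> C n"
        and C: "\<And>n. closedin (subtopology (K n) (B n)) (C n)" "\<And>n. C n \<subseteq> B n \<inter> W n"
        by metis
      have "\<exists>i\<in>J'. countably_separated (subtopology (K i) (C i))"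
      proof (rule Suc.IH[OF _ _ _ _ _ J'])
        show "finite (insert \<gamma> F)" "insert \<gamma> F \<subseteq> \<Gamma>" using Suc.prems \<gamma> by auto
        show "closedin (K n) (C n)" for n
          using C(1) Suc.prems(3) closedin_trans_full by blast
        show "C n \<noteq> {}" for n using U by blast
        fix x assume x: "\<And>n. x n \<in> C n"
        then have xB: "x n \<in> B n" and xW: "x n \<in> W n" for n using C(2) by blast+
        let ?S = "{\<gamma>\<in>\<Gamma>. f x \<gamma> \<noteq> a \<gamma>}"
        have "finite ?S" using xB B by (intro fin) blast
        moreover have "\<gamma> \<in> ?S - F" using W(3)[OF xW] \<gamma> by (auto simp: V_def)
        \<comment> \<open>Moving \<open>\<gamma>\<close> into \<open>F\<close> removes one element
          from the counted part of every support over the new box, so the bound falls from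
          \<open>Suc m\<close> to \<open>m\<close>.\<close>
        ultimately have "card (?S - insert \<gamma> F) < card (?S - F)"
          by (intro psubset_card_mono) auto
        then show "card (?S - insert \<gamma> F) \<le> m" using Suc.prems(5)[OF xB] by simp
      qed
      then obtain i where i: "i \<in> J'" "countably_separated (subtopology (K i) (C i))" by blast
      \<comment> \<open>Varying coordinate \<open>j\<close> left the coordinates in
        \<open>J'\<close> unchanged, so \<open>C i\<close> is a countably separated closed
        neighbourhood of the bad point \<open>p i\<close>.\<close>
      have "y i = p i" using i(1) by (auto simp: y_def b_def J'_def)
      moreover have "subtopology (subtopology (K i) (B i)) (C i) = subtopology (K i) (C i)"
        using C(2)[of i] by (simp add: subtopology_subtopology inf_absorb2)
      ultimately show False using nonsep[OF i(1) U(1) C(1) _ U(3)] U(2)[of i] i(2) by simp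
    qed
  }
qed

section \<open>Baire category argument on the full product\<close>

theorem corollary5p2:
  fixes K :: "nat \<Rightarrow> 'a topology"
  assumes "\<And>n. Eberlein_compact TYPE('v::real_vector) (K n)"
    and "\<And>n. \<not> metrizable_space (K n)"
  shows "\<not> NY_compact TYPE('i) TYPE('x) (product_topology K UNIV)"
proof
  let ?P = "product_topology K UNIV"
  assume NY: "NY_compact TYPE('i) TYPE('x) ?P"
  have K: "compact_space (K n)" "Hausdorff_space (K n)" for n
    using assms(1) by (auto simp: Eberlein_compact_def)
  have nonsep: "\<not> countably_separated (K n)" for n
    using assms(2) compact_countably_separated_imp_metrizable K(1) by blast
  \<comment> \<open>The empty space is vacuously countably separated.\<close>
  have ne: "topspace (K n) \<noteq> {}" for n
    using nonsep[of n] by (auto simp: countably_separated_def)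
  obtain \<Gamma> :: "'i set" and X :: "'i \<Rightarrow> 'x topology" and a f where
    X: "\<And>\<gamma>. \<gamma> \<in> \<Gamma> \<Longrightarrow> compact_space (X \<gamma>)" "\<And>\<gamma>. \<gamma> \<in> \<Gamma> \<Longrightarrow> metrizable_space (X \<gamma>)"
    and emb: "embedding_map ?P (sigma_product X a \<Gamma>) f"
    using NY unfolding NY_compact_def by metis
  have cf: "continuous_map ?P (sigma_product X a \<Gamma>) f"
    using emb unfolding embedding_map_def
    by (meson continuous_map_in_subtopology homeomorphic_imp_continuous_map)
  have "inj_on f (topspace ?P)"
    using emb by (simp add: embedding_map_def homeomorphic_eq_everything_map)
  have P: "x \<in> topspace ?P \<longleftrightarrow> (\<forall>n. x n \<in> topspace (K n))" for x
    by (auto simp: PiE_UNIV_domain)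
  have im: "f x \<in> topspace (product_topology X \<Gamma>)" "finite {\<gamma>\<in>\<Gamma>. f x \<gamma> \<noteq> a \<gamma>}"
    if "x \<in> topspace ?P" for x
  proof -
    have "f x \<in> topspace (sigma_product X a \<Gamma>)"
      using continuous_map_image_subset_topspace[OF cf] that by blast
    then show "f x \<in> topspace (product_topology X \<Gamma>)" "finite {\<gamma>\<in>\<Gamma>. f x \<gamma> \<noteq> a \<gamma>}"
      by (simp_all add: sigma_product_def)
  qed
  have cont: "continuous_map ?P (X \<gamma>) (\<lambda>x. f x \<gamma>)" if "\<gamma> \<in> \<Gamma>" for \<gamma>
    using cf that unfolding sigma_product_def continuous_map_in_subtopology
    by (auto simp: continuous_map_componentwise)
  have inj: "x = y" if "x \<in> topspace ?P" "y \<in> topspace ?P" "\<And>\<gamma>. \<gamma> \<in> \<Gamma> \<Longrightarrow> f x \<gamma> = f y \<gamma>" for x y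
  proof -
    have "f x = f y"
      using im(1)[OF that(1)] im(1)[OF that(2)] that(3) by (auto intro: PiE_ext)
    then show ?thesis using \<open>inj_on f (topspace ?P)\<close> that by (simp add: inj_on_eq_iff)
  qed
  have t1: "t1_space (X \<gamma>)" if "\<gamma> \<in> \<Gamma>" for \<gamma>
    using X that metrizable_imp_t1_space by blast
  define S where "S x = {\<gamma>\<in>\<Gamma>. f x \<gamma> \<noteq> a \<gamma>}" for x
  define T where "T m = {x \<in> topspace ?P. card (S x) \<le> m}" for m
  have finS: "finite (S x)" if "x \<in> topspace ?P" for x
    using im(2)[OF that] by (simp add: S_def)
  have closedT: "closedin ?P (T m)" for m
  proof -
    \<comment> \<open>Each of the finitely many support elements of \<open>x\<close> persists on a
      neighbourhood. On their intersection \<open>N\<close> supports contain \<open>S x\<close>,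
      hence have more than \<open>m\<close> elements.\<close>
    have "openin ?P (topspace ?P - T m)"
    proof (subst openin_subopen, intro ballI)
      fix x assume x: "x \<in> topspace ?P - T m"
      define N where
        "N = (\<Inter>\<gamma>\<in>S x. {z \<in> topspace ?P. f z \<gamma> \<in> topspace (X \<gamma>) - {a \<gamma>}}) \<inter> topspace ?P"
      have "openin ?P {z \<in> topspace ?P. f z \<gamma> \<in> topspace (X \<gamma>) - {a \<gamma>}}" if "\<gamma> \<in> S x" for \<gamma>
      proof -
        have "\<gamma> \<in> \<Gamma>" using that by (simp add: S_def)
        then show ?thesis
          using t1 by (intro openin_continuous_map_preimage[OF cont])
            (auto simp: t1_space_openin_delete_alt)
      qed
      then have "openin ?P N"
        unfolding N_def using finS x by (intro openin_INT) auto
      moreover have "x \<in> N" using x im(1)[of x] by (auto simp: N_def S_def PiE_iff)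
      moreover have "N \<subseteq> topspace ?P - T m"
      proof
        fix z assume z: "z \<in> N"
        then have "S x \<subseteq> S z" by (auto simp: N_def S_def)
        then have "card (S x) \<le> card (S z)" using finS z by (intro card_mono) (auto simp: N_def)
        then show "z \<in> topspace ?P - T m" using x z by (auto simp: T_def N_def)
      qed
      ultimately show "\<exists>N. openin ?P N \<and> x \<in> N \<and> N \<subseteq> topspace ?P - T m" by blast
    qed
    then show ?thesis by (auto simp: closedin_def T_def)
  qed
  \<comment> \<open>The closed sets \<open>T m\<close> cover the nonempty compact Hausdorff product
    because all supports are finite, so they cannot all have empty interior.\<close>
  have "\<exists>m. ?P interior_of T m \<noteq> {}"
  proof (rule ccontr)
    assume "\<not> ?thesis"
    moreover have "compact_space ?P" "regular_space ?P"
      using NY compact_Hausdorff_imp_regular_space by (auto simp: NY_compact_def)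
    ultimately have "?P interior_of \<Union>(range T) = {}"
      using closedT by (intro Baire_category_alt) (auto intro: compact_imp_locally_compact_space)
    moreover have "\<Union>(range T) = topspace ?P" by (auto simp: T_def)
    ultimately have "topspace ?P = {}" by (metis interior_of_topspace)
    then show False using ne by (simp add: PiE_eq_empty_iff)
  qed
  then obtain m y where y: "y \<in> ?P interior_of T m" by blast
  obtain W where W: "\<And>n. openin (K n) (W n)" "\<And>n. y n \<in> W n"
      "finite {n. W n \<noteq> topspace (K n)}"
      "\<And>x. (\<And>n. x n \<in> W n) \<Longrightarrow> x \<in> ?P interior_of T m"
    using product_topology_open_box[OF openin_interior_of y] by metis
  \<comment> \<open>Freezing the restricted coordinates at \<open>y\<close> gives a closed box
    inside the open one, while every unrestricted factor is kept whole.\<close>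
  define B where "B n = (if W n = topspace (K n) then topspace (K n) else {y n})" for n
  \<comment> \<open>The open box restricts only finitely many of the infinitely many coordinates, so
    \<open>m + 1\<close> free factors are available for \<open>J\<close>.\<close>
  have "infinite {n. W n = topspace (K n)}"
    using W(3) by (metis (full_types) Collect_neg_eq finite_compl infinite_UNIV_nat)
  then obtain J where J: "J \<subseteq> {n. W n = topspace (K n)}" "card J = Suc m"
    using infinite_arbitrarily_large by blast
  have "\<exists>j\<in>J. countably_separated (subtopology (K j) (B j))"
  proof (rule bounded_support_imp_countably_separated_factor[
        where K = K and X = X and \<Gamma> = \<Gamma> and f = f and a = a and F = "{}" and m = m])
    show "closedin (K n) (B n)" for n
    proof -
      have "y n \<in> topspace (K n)" using W(1,2)[of n] openin_subset by blast
      then show ?thesis using K(2) by (simp add: B_def closedin_Hausdorff_singleton)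
    qed
    show "B n \<noteq> {}" for n using ne by (simp add: B_def)
    fix x assume x: "\<And>n. x n \<in> B n"
    have "x n \<in> W n" for n using W(2)[of n] x[of n] by (auto simp: B_def split: if_splits)
    then have "x \<in> T m" using W(4)[of x] interior_of_subset[of ?P "T m"] by blast
    then show "card ({\<gamma>\<in>\<Gamma>. f x \<gamma> \<noteq> a \<gamma>} - {}) \<le> m" by (simp add: T_def S_def)
  next
    show "x = y" if "\<And>n. x n \<in> topspace (K n)" "\<And>n. y n \<in> topspace (K n)"
      "\<And>\<gamma>. \<gamma> \<in> \<Gamma> \<Longrightarrow> f x \<gamma> = f y \<gamma>" for x y
      by (rule inj) (use that P in auto)
    show "finite {\<gamma>\<in>\<Gamma>. f x \<gamma> \<noteq> a \<gamma>}" if "\<And>n. x n \<in> topspace (K n)" for x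
      by (rule im(2)) (use that P in auto)
    show "countably_separated (X \<gamma>)" if "\<gamma> \<in> \<Gamma>" for \<gamma>
      using X[OF that] compact_metrizable_imp_countably_separated by blast
  qed (use K t1 cont J(2) in simp_all)
  then obtain j where "j \<in> J" "countably_separated (subtopology (K j) (B j))" by blast
  \<comment> \<open>For \<open>j\<close> in \<open>J\<close> the set \<open>B j\<close> is all of
    \<open>K j\<close>, which is not countably separated.\<close>
  then show False using J(1) nonsep by (auto simp: B_def)
qed

end
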